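(* Let $n\ge 2$, and denote by $\mathrm{GL}(n,\mathbb{Z})_{\mathrm{odd}}\subset \mathrm{GL}(n,\mathbb{Z})$ the subgroup of matrices such that each column has an odd number of odd entries. Then the following hold. (1) The group $\mathrm{GL}(n,\mathbb{Z})_{\mathrm{odd}}$ is a maximal subgroup of $\mathrm{GL}(n,\mathbb{Z})$, and has index $2^{n}-1$. (2) If $n\ge 3$, then $\mathrm{GL}(n,\mathbb{Z})_{\mathrm{odd}}$ is generated by the group of permutation matrices and the three matrices $$M_\theta=I_n-2E_{1,1},\qquad M_\mu=I_n+2E_{2,1},\qquad M_\nu=I_n+E_{2,1}+E_{3,1}.$$
   Context: $I_n$ is the $n\times n$ identity matrix and $E_{i,j}$ is the $n\times n$ matrix whose only non-zero entry is a $1$ in row $i$ and column $j$. Thus $M_\theta$ is the diagonal matrix $\mathrm{diag}(-1,1,\dots,1)$; $M_\mu$ is the identity matrix with the $(2,1)$-entry replaced by $2$; $M_\nu$ is the identity matrix with the $(2,1)$- and $(3,1)$-entries replaced by $1$. *)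

theory Defs
  imports "Jordan_Normal_Form.Matrix" "HOL-Algebra.Coset" "HOL-Algebra.Generated_Groups"
    "HOL-Combinatorics.Permutations"
begin

definition GL_int :: "nat \<Rightarrow> int mat monoid" where
  "GL_int n = units_of (ring_mat TYPE(int) n ())"

lemma group_GL_int: "group (GL_int n)"
  unfolding GL_int_def
  by (intro monoid.units_group semiring.axioms(2) semiring_mat)

definition GL_int_odd :: "nat \<Rightarrow> int mat set" where
  "GL_int_odd n =
     {A \<in> carrier (GL_int n). \<forall>j<n. odd (card {i. i < n \<and> odd (A $$ (i, j))})}"

definition maximal_subgroup :: "'a set \<Rightarrow> ('a, 'b) monoid_scheme \<Rightarrow> bool" where
  "maximal_subgroup H G \<longleftrightarrow>
     subgroup H G \<and> H \<noteq> carrier G \<and>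
     (\<forall>K. subgroup K G \<longrightarrow> H \<subseteq> K \<longrightarrow> K = H \<or> K = carrier G)"

definition permutation_matrices :: "nat \<Rightarrow> int mat set" where
  "permutation_matrices n =
     {mat n n (\<lambda>(i, j). if i = p j then 1 else 0) | p. p permutes {..<n}}"

(* Rows and columns of matrices are numbered from 0, so unit_matrix n i j is the matrix
   usually written E_{i+1,j+1}. *)
definition unit_matrix :: "nat \<Rightarrow> nat \<Rightarrow> nat \<Rightarrow> int mat" where
  "unit_matrix n i j = mat n n (\<lambda>(k, l). if k = i \<and> l = j then 1 else 0)"

definition M_theta :: "nat \<Rightarrow> int mat" where
  "M_theta n = 1\<^sub>m n - 2 \<cdot>\<^sub>m unit_matrix n 0 0"

definition M_mu :: "nat \<Rightarrow> int mat" where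
  "M_mu n = 1\<^sub>m n + 2 \<cdot>\<^sub>m unit_matrix n 1 0"

definition M_nu :: "nat \<Rightarrow> int mat" where
  "M_nu n = 1\<^sub>m n + unit_matrix n 1 0 + unit_matrix n 2 0"

end

theory Submission
  imports Defs
begin

text \<open>
  Identifying subsets of \<open>{..<n}\<close> with row vectors over the field with two elements,
  \<open>GL(n, \<int>)\<^sub>o\<^sub>d\<^sub>d\<close> is the stabiliser of the all-ones vector under right multiplication. The orbit of
  this vector consists of all \<open>2^n - 1\<close> nonzero vectors, which gives the index. The stabiliser is
  transitive on the remaining nonzero vectors (permute coordinates, then apply a single transvection
  \<open>1 + u w\<^sup>T\<close>), so the action is doubly transitive and the stabiliser is maximal.

  For generation, conjugating and multiplying the given matrices yields every
  \<open>1 + u e\<^sub>k\<^sup>T\<close> with \<open>u\<^sub>k = 0\<close> and even coordinate sum. These row operations bring a matrix to the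
  identity column by column: in the current column, below the finished rows, twice a smaller entry
  can be subtracted from a larger one until all nonzero entries are \<open>\<plusminus>1\<close>; such entries are then
  removed in pairs, or one at a time when a finished row can absorb the parity.
\<close>

section \<open>Transvections, permutation matrices and their products\<close>

definition transvection :: "nat \<Rightarrow> (nat \<Rightarrow> int) \<Rightarrow> (nat \<Rightarrow> int) \<Rightarrow> int mat" where
  "transvection n u w = mat n n (\<lambda>(i, j). of_bool (i = j) + u i * w j)"

definition perm_matrix :: "nat \<Rightarrow> (nat \<Rightarrow> nat) \<Rightarrow> int mat" where
  "perm_matrix n p = mat n n (\<lambda>(i, j). if i = p j then 1 else 0)"

abbreviation basis_vec :: "nat \<Rightarrow> nat \<Rightarrow> int" where
  "basis_vec k \<equiv> (\<lambda>i. of_bool (i = k))"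

text \<open>A set stands for its indicator row vector mod 2, and the value for that vector times
  \<open>A\<close>. Multiplying on the right gives a right action, so the fibres of an orbit map are
  right cosets of the stabiliser.\<close>

definition parity_act :: "nat \<Rightarrow> nat set \<Rightarrow> int mat \<Rightarrow> nat set" where
  "parity_act n X A = {j. j < n \<and> odd (\<Sum>i\<in>X. A $$ (i, j))}"

lemma sum_basis_vec:
  fixes f :: "nat \<Rightarrow> int"
  assumes "a < n"
  shows "(\<Sum>k<n. of_bool (k = a) * f k) = f a" "(\<Sum>k<n. of_bool (a = k) * f k) = f a"
    "(\<Sum>k<n. f k * of_bool (k = a)) = f a" "(\<Sum>k<n. f k * of_bool (a = k)) = f a"
proof -
  have *: "{..<n} \<inter> {k. k = a} = {a}" "{..<n} \<inter> {k. a = k} = {a}"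
    using assms by auto
  show "(\<Sum>k<n. of_bool (k = a) * f k) = f a" "(\<Sum>k<n. of_bool (a = k) * f k) = f a"
    "(\<Sum>k<n. f k * of_bool (k = a)) = f a" "(\<Sum>k<n. f k * of_bool (a = k)) = f a"
    by (simp_all only: sum_of_bool_mult_eq sum_mult_of_bool_eq finite_lessThan *) simp_all
qed

lemma index_mult_mat_sum:
  assumes "A \<in> carrier_mat n m" "B \<in> carrier_mat m l" "i < n" "j < l"
  shows "(A * B) $$ (i, j) = (\<Sum>k<m. A $$ (i, k) * B $$ (k, j))"
  using assms by (simp add: scalar_prod_def atLeast0LessThan)

lemma carrier_GL_int:
  "A \<in> carrier (GL_int n) \<longleftrightarrow>
     A \<in> carrier_mat n n \<and> (\<exists>B\<in>carrier_mat n n. A * B = 1\<^sub>m n \<and> B * A = 1\<^sub>m n)"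
  by (auto simp: GL_int_def units_of_def Units_def ring_mat_def)

lemma mult_GL_int [simp]: "A \<otimes>\<^bsub>GL_int n\<^esub> B = A * B"
  by (simp add: GL_int_def units_of_def ring_mat_def)

lemma one_GL_int [simp]: "\<one>\<^bsub>GL_int n\<^esub> = 1\<^sub>m n"
  by (simp add: GL_int_def units_of_def ring_mat_def)

lemma GL_int_carrier_mat: "A \<in> carrier (GL_int n) \<Longrightarrow> A \<in> carrier_mat n n"
  by (simp add: carrier_GL_int)

lemma transvection_carrier [simp]: "transvection n u w \<in> carrier_mat n n"
  by (simp add: transvection_def)

lemma perm_matrix_carrier [simp]: "perm_matrix n p \<in> carrier_mat n n"
  by (simp add: perm_matrix_def)

lemma transvection_index [simp]:
  "i < n \<Longrightarrow> j < n \<Longrightarrow> transvection n u w $$ (i, j) = of_bool (i = j) + u i * w j"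
  by (simp add: transvection_def)

lemma perm_matrix_index [simp]:
  "i < n \<Longrightarrow> j < n \<Longrightarrow> perm_matrix n p $$ (i, j) = of_bool (i = p j)"
  by (simp add: perm_matrix_def)

text \<open>The cross term u w^T v w^T is (w . v) u w^T. Nothing is assumed about w . v, so this
  covers both the additive case w . v = 0 and the square of a reflection, where it is -2.\<close>

lemma transvection_mult:
  "transvection n u w * transvection n v w =
     transvection n (\<lambda>i. u i + v i + (\<Sum>k<n. w k * v k) * u i) w"
proof (rule eq_matI)
  fix i j
  assume "i < dim_row (transvection n (\<lambda>i. u i + v i + (\<Sum>k<n. w k * v k) * u i) w)"
    and "j < dim_col (transvection n (\<lambda>i. u i + v i + (\<Sum>k<n. w k * v k) * u i) w)"
  then have ij: "i < n" "j < n"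
    by (simp_all add: transvection_def)
  have "(transvection n u w * transvection n v w) $$ (i, j) =
      (\<Sum>k<n. (of_bool (i = k) + u i * w k) * (of_bool (k = j) + v k * w j))"
    using ij by (subst index_mult_mat_sum[of _ n n _ n]) auto
  also have "\<dots> = (\<Sum>k<n. of_bool (i = k) * of_bool (k = j)) + (\<Sum>k<n. of_bool (i = k) * (v k * w j))
      + (\<Sum>k<n. u i * w k * of_bool (k = j)) + (\<Sum>k<n. w k * v k * (u i * w j))"
    unfolding sum.distrib[symmetric] by (rule sum.cong) (simp_all add: algebra_simps)
  also have "\<dots> = of_bool (i = j) + v i * w j + u i * w j + (\<Sum>k<n. w k * v k) * (u i * w j)"
    using ij by (simp add: sum_basis_vec sum_distrib_right del: sum_of_bool_mult_eq sum_mult_of_bool_eq)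
  finally show "(transvection n u w * transvection n v w) $$ (i, j) =
      transvection n (\<lambda>i. u i + v i + (\<Sum>k<n. w k * v k) * u i) w $$ (i, j)"
    using ij by (simp add: algebra_simps)
qed (simp_all add: transvection_def)

lemma transvection_zero: "transvection n (\<lambda>i. 0) w = 1\<^sub>m n"
  by (rule eq_matI) (auto simp: transvection_def)

text \<open>With w . u = 0 the product formula is additive in the first vector, so the inverse is 1
  - u w^T.\<close>

lemma transvection_GL_int:
  assumes "(\<Sum>i<n. w i * u i) = 0"
  shows "transvection n u w \<in> carrier (GL_int n)"
proof -
  have "(\<Sum>i<n. w i * - u i) = 0"
    using assms by (simp add: sum_negf)
  then have "transvection n u w * transvection n (\<lambda>i. - u i) w = 1\<^sub>m n"
    "transvection n (\<lambda>i. - u i) w * transvection n u w = 1\<^sub>m n"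
    using assms by (simp_all add: transvection_mult transvection_zero)
  then show ?thesis
    unfolding carrier_GL_int by (meson transvection_carrier)
qed

lemma perm_matrix_mult:
  assumes "q permutes {..<n}"
  shows "perm_matrix n p * perm_matrix n q = perm_matrix n (p \<circ> q)"
proof (rule eq_matI)
  fix i j
  assume "i < dim_row (perm_matrix n (p \<circ> q))" "j < dim_col (perm_matrix n (p \<circ> q))"
  then have ij: "i < n" "j < n"
    by (simp_all add: perm_matrix_def)
  moreover have "q j < n"
    using permutes_in_image[OF assms, of j] ij by simp
  ultimately show "(perm_matrix n p * perm_matrix n q) $$ (i, j) = perm_matrix n (p \<circ> q) $$ (i, j)"
    by (subst index_mult_mat_sum[of _ n n _ n]) (auto simp: sum_basis_vec del: sum_of_bool_mult_eq sum_mult_of_bool_eq)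
qed (simp_all add: perm_matrix_def)

lemma perm_matrix_id: "perm_matrix n id = 1\<^sub>m n"
  by (rule eq_matI) (auto simp: perm_matrix_def)

lemma perm_matrix_GL_int:
  assumes "p permutes {..<n}"
  shows "perm_matrix n p \<in> carrier (GL_int n)"
proof -
  have "perm_matrix n p * perm_matrix n (inv_into UNIV p) = 1\<^sub>m n"
    "perm_matrix n (inv_into UNIV p) * perm_matrix n p = 1\<^sub>m n"
    using assms by (simp_all add: perm_matrix_mult permutes_inv permutes_inv_o perm_matrix_id)
  then show ?thesis
    unfolding carrier_GL_int by (meson perm_matrix_carrier)
qed

text \<open>Conjugation by a permutation matrix relabels the coordinates of \<open>u\<close> and
  \<open>w\<close>; the commutation form keeps the inverse matrix out of the computation.\<close>

lemma perm_matrix_transvection: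
  assumes "p permutes {..<n}"
  shows "perm_matrix n p * transvection n (u \<circ> p) (w \<circ> p) = transvection n u w * perm_matrix n p"
proof (rule eq_matI)
  fix i j
  assume "i < dim_row (transvection n u w * perm_matrix n p)"
    "j < dim_col (transvection n u w * perm_matrix n p)"
  then have ij: "i < n" "j < n"
    by (simp_all add: transvection_def perm_matrix_def)
  have pj: "p j < n"
    using permutes_in_image[OF assms, of j] ij by simp
  obtain l where l: "l < n" "i = p l"
    using permutes_image[OF assms] ij by (metis imageE lessThan_iff)
  have inj: "p l = p k \<longleftrightarrow> l = k" for k
    using permutes_inj[OF assms] by (auto dest: injD)
  have "(perm_matrix n p * transvection n (u \<circ> p) (w \<circ> p)) $$ (i, j) =
      (\<Sum>k<n. of_bool (l = k) * (of_bool (k = j) + u (p k) * w (p j)))"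
    using ij l inj by (subst index_mult_mat_sum[of _ n n _ n]) auto
  also have "\<dots> = of_bool (l = j) + u i * w (p j)"
    using l by (simp add: sum_basis_vec del: sum_of_bool_mult_eq sum_mult_of_bool_eq)
  finally have 1: "(perm_matrix n p * transvection n (u \<circ> p) (w \<circ> p)) $$ (i, j) =
      of_bool (l = j) + u i * w (p j)" .
  have "(transvection n u w * perm_matrix n p) $$ (i, j) =
      (\<Sum>k<n. (of_bool (i = k) + u i * w k) * of_bool (k = p j))"
    using ij by (subst index_mult_mat_sum[of _ n n _ n]) auto
  also have "\<dots> = of_bool (i = p j) + u i * w (p j)"
    using pj by (simp add: sum_basis_vec del: sum_of_bool_mult_eq sum_mult_of_bool_eq)
  finally show "(perm_matrix n p * transvection n (u \<circ> p) (w \<circ> p)) $$ (i, j) =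
      (transvection n u w * perm_matrix n p) $$ (i, j)"
    using 1 inj l by simp
qed (simp_all add: transvection_def perm_matrix_def)

text \<open>The form in which the column reduction uses transvections: a single matrix adds
  multiples of row \<open>k\<close> to all rows at once.\<close>

lemma transvection_basis_mult_index:
  assumes "A \<in> carrier_mat n n" "i < n" "j < n" "k < n"
  shows "(transvection n u (basis_vec k) * A) $$ (i, j) = A $$ (i, j) + u i * A $$ (k, j)"
  using assms
  by (subst index_mult_mat_sum[of _ n n _ n])
    (auto simp: distrib_right sum.distrib mult.assoc sum_distrib_left[symmetric] sum_basis_vec del: sum_of_bool_mult_eq sum_mult_of_bool_eq)

lemma perm_matrix_mult_index:
  assumes "A \<in> carrier_mat n n" "p permutes {..<n}" "i < n" "j < n"
  shows "(perm_matrix n p * A) $$ (p i, j) = A $$ (i, j)"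
proof -
  have "p i < n"
    using permutes_in_image[OF assms(2), of i] assms(3) by simp
  moreover have "p i = p k \<longleftrightarrow> i = k" for k
    using permutes_inj[OF assms(2)] by (auto dest: injD)
  ultimately show ?thesis
    using assms
    by (subst index_mult_mat_sum[of _ n n _ n])
      (auto simp: sum_basis_vec del: sum_of_bool_mult_eq sum_mult_of_bool_eq)
qed

text \<open>Iterating this builds permutations with two or three prescribed values. Following
  \<open>p\<close> by the transposition of \<open>p x\<close> and \<open>y\<close> disturbs only
  \<open>x\<close> and the point that \<open>p\<close> sends to \<open>y\<close>.\<close>

lemma permutes_redirect:
  assumes "p permutes U" "x \<in> U" "y \<in> U"
  shows "\<exists>q. q permutes U \<and> q x = y \<and> (\<forall>z. z \<noteq> x \<longrightarrow> p z \<noteq> y \<longrightarrow> q z = p z)"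
proof (intro exI conjI allI impI)
  show "transpose (p x) y \<circ> p permutes U"
    using assms permutes_in_image[OF assms(1)] by (intro permutes_compose permutes_swap_id) auto
  show "(transpose (p x) y \<circ> p) z = p z" if "z \<noteq> x" "p z \<noteq> y" for z
    using that permutes_inj[OF assms(1)] by (auto simp: transpose_def dest: injD)
qed simp

section \<open>The action on sets modulo 2 and the stabiliser of the full set\<close>

text \<open>Mod 2 a coefficient is 0 or 1, so a linear combination is a sum over the support of its
  coefficients. This passes from vectors to the sets of \<open>parity_act\<close>.\<close>

lemma odd_sum_mult:
  fixes f g :: "'a \<Rightarrow> int"
  assumes "finite F"
  shows "odd (\<Sum>k\<in>F. f k * g k) \<longleftrightarrow> odd (\<Sum>k\<in>{k\<in>F. odd (f k)}. g k)"
  using assms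
proof (induction F rule: finite_induct)
  case (insert x F)
  have "{k \<in> insert x F. odd (f k)} =
      (if odd (f x) then insert x {k \<in> F. odd (f k)} else {k \<in> F. odd (f k)})"
    by auto
  then show ?case
    using insert by simp
qed simp

lemma parity_act_mult:
  assumes "A \<in> carrier_mat n n" "B \<in> carrier_mat n n" "X \<subseteq> {..<n}"
  shows "parity_act n X (A * B) = parity_act n (parity_act n X A) B"
proof -
  have "odd (\<Sum>i\<in>X. (A * B) $$ (i, j)) \<longleftrightarrow> odd (\<Sum>k\<in>parity_act n X A. B $$ (k, j))" if "j < n" for j
  proof -
    have "(\<Sum>i\<in>X. (A * B) $$ (i, j)) = (\<Sum>i\<in>X. \<Sum>k<n. A $$ (i, k) * B $$ (k, j))"
      using assms that by (intro sum.cong) (auto intro!: index_mult_mat_sum)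
    also have "\<dots> = (\<Sum>k<n. (\<Sum>i\<in>X. A $$ (i, k)) * B $$ (k, j))"
      by (subst sum.swap) (simp add: sum_distrib_right)
    finally show ?thesis
      by (simp add: odd_sum_mult parity_act_def)
  qed
  then show ?thesis
    unfolding parity_act_def[of n X "A * B"] parity_act_def[of n "parity_act n X A" B] by blast
qed

lemma parity_act_subset: "parity_act n X A \<subseteq> {..<n}"
  by (auto simp: parity_act_def)

lemma parity_act_one: "X \<subseteq> {..<n} \<Longrightarrow> parity_act n X (1\<^sub>m n) = X"
proof -
  assume X: "X \<subseteq> {..<n}"
  have "(\<Sum>i\<in>X. (1\<^sub>m n :: int mat) $$ (i, j)) = of_bool (j \<in> X)" if "j < n" for j
  proof -
    have "(\<Sum>i\<in>X. (1\<^sub>m n :: int mat) $$ (i, j)) = (\<Sum>i\<in>X. if i = j then 1 else 0)"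
      using X that by (intro sum.cong) auto
    then show ?thesis
      using finite_subset[OF X] by simp
  qed
  then show ?thesis
    using X by (auto simp: parity_act_def)
qed

lemma parity_act_perm_matrix:
  assumes "p permutes {..<n}" "X \<subseteq> {..<n}"
  shows "parity_act n X (perm_matrix n p) = {j. j < n \<and> p j \<in> X}"
proof -
  have "(\<Sum>i\<in>X. perm_matrix n p $$ (i, j)) = of_bool (p j \<in> X)" if "j < n" for j
  proof -
    have "(\<Sum>i\<in>X. perm_matrix n p $$ (i, j)) = (\<Sum>i\<in>X. if i = p j then 1 else 0)"
      using assms that by (intro sum.cong) auto
    then show ?thesis
      using finite_subset[OF assms(2)] by simp
  qed
  then show ?thesis
    by (auto simp: parity_act_def)
qed

lemma parity_act_transvection:
  assumes "X \<subseteq> {..<n}"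
  shows "parity_act n X (transvection n u w) =
    {j. j < n \<and> odd (of_bool (j \<in> X) + (\<Sum>i\<in>X. u i) * w j)}"
proof -
  have "(\<Sum>i\<in>X. transvection n u w $$ (i, j)) = of_bool (j \<in> X) + (\<Sum>i\<in>X. u i) * w j" if "j < n" for j
  proof -
    have "(\<Sum>i\<in>X. transvection n u w $$ (i, j)) = (\<Sum>i\<in>X. (if i = j then 1 else 0) + u i * w j)"
      using assms that by (intro sum.cong) auto
    then show ?thesis
      using finite_subset[OF assms] by (simp add: sum.distrib sum_distrib_right)
  qed
  then show ?thesis
    by (auto simp: parity_act_def)
qed

text \<open>A sum of integers is odd exactly when an odd number of its terms are odd. The condition
  on the columns therefore says that the all-ones vector is fixed.\<close>

lemma mem_GL_int_odd:
  "A \<in> GL_int_odd n \<longleftrightarrow> A \<in> carrier (GL_int n) \<and> parity_act n {..<n} A = {..<n}"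
proof -
  have "odd (card {i. i < n \<and> odd (A $$ (i, j))}) \<longleftrightarrow> odd (\<Sum>i<n. A $$ (i, j))" for j
    using even_sum_iff[of "{..<n}" "\<lambda>i. A $$ (i, j)"] by simp
  then show ?thesis
    by (auto simp: GL_int_odd_def parity_act_def)
qed

lemma subgroup_GL_int_odd: "subgroup (GL_int_odd n) (GL_int n)"
proof -
  interpret group "GL_int n" by (rule group_GL_int)
  show ?thesis
  proof (rule subgroupI)
    show "GL_int_odd n \<noteq> {}"
      using one_closed mem_GL_int_odd[of "1\<^sub>m n" n] parity_act_one[of "{..<n}" n] by auto
  next
    fix A assume A: "A \<in> GL_int_odd n"
    let ?B = "inv\<^bsub>GL_int n\<^esub> A"
    have *: "A * ?B = 1\<^sub>m n" "?B \<in> carrier (GL_int n)"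
      using A r_inv[of A] by (auto simp: mem_GL_int_odd)
    then show "?B \<in> GL_int_odd n"
      using A parity_act_mult[of A n ?B "{..<n}"] parity_act_one[of "{..<n}" n]
      by (auto simp: mem_GL_int_odd GL_int_carrier_mat)
  next
    fix A B assume "A \<in> GL_int_odd n" "B \<in> GL_int_odd n"
    then show "A \<otimes>\<^bsub>GL_int n\<^esub> B \<in> GL_int_odd n"
      using m_closed[of A B] by (auto simp: mem_GL_int_odd parity_act_mult GL_int_carrier_mat)
  qed (auto simp: mem_GL_int_odd)
qed

lemma perm_matrix_GL_int_odd: "p permutes {..<n} \<Longrightarrow> perm_matrix n p \<in> GL_int_odd n"
  using permutes_in_image[of p "{..<n}"]
  by (auto simp: mem_GL_int_odd perm_matrix_GL_int parity_act_perm_matrix)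

text \<open>All-ones pairs with \<open>u\<close> to an even number, so it is fixed whatever
  \<open>w\<close> is. Membership in the group is assumed instead of w . u = 0 so that reflections
  are covered too.\<close>

lemma transvection_GL_int_odd:
  assumes "transvection n u w \<in> carrier (GL_int n)" "even (\<Sum>i<n. u i)"
  shows "transvection n u w \<in> GL_int_odd n"
proof -
  have "parity_act n {..<n} (transvection n u w) = {j. j < n}"
    unfolding parity_act_transvection[OF subset_refl] using assms(2) by simp
  then show ?thesis
    using assms(1) by (simp add: mem_GL_int_odd lessThan_def)
qed

section \<open>Orbits of the full group and of the stabiliser\<close>

text \<open>When x . u is odd, x goes to x + w, so w = y - x takes x to y. The signed difference is
  exactly 0 wherever \<open>X\<close> and \<open>Y\<close> agree; placing the support of
  \<open>u\<close> there gives w . u = 0.\<close>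

lemma parity_act_transvection_indicator:
  fixes u :: "nat \<Rightarrow> int"
  assumes "X \<subseteq> {..<n}" "Y \<subseteq> {..<n}" "odd (\<Sum>i\<in>X. u i)"
  shows "parity_act n X (transvection n u (\<lambda>i. of_bool (i \<in> Y) - of_bool (i \<in> X))) = Y"
proof -
  have "odd (of_bool P + s * (of_bool Q - of_bool P)) \<longleftrightarrow> Q" if "odd s" for P Q and s :: int
    using that by (cases P; cases Q) simp_all
  then show ?thesis
    using assms by (simp add: parity_act_transvection) blast
qed

text \<open>For \<open>a\<close> in \<open>Y\<close> take u = e_a: the difference between
  \<open>Y\<close> and the full set vanishes at \<open>a\<close>, which makes the transvection
  invertible, and all-ones pairs with \<open>u\<close> to 1.\<close>

lemma parity_act_full_surj:
  assumes "Y \<subseteq> {..<n}" "Y \<noteq> {}"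
  shows "\<exists>A\<in>carrier (GL_int n). parity_act n {..<n} A = Y"
proof -
  obtain a where a: "a \<in> Y" "a < n"
    using assms by auto
  let ?w = "\<lambda>i. of_bool (i \<in> Y) - of_bool (i \<in> {..<n}) :: int"
  have "(\<Sum>i<n. ?w i * basis_vec a i) = ?w a"
    using a by (simp add: sum_basis_vec del: sum_of_bool_mult_eq sum_mult_of_bool_eq)
  then have "transvection n (basis_vec a) ?w \<in> carrier (GL_int n)"
    using a by (intro transvection_GL_int) simp
  moreover have "(\<Sum>i<n. basis_vec a i) = 1"
    using a by (simp add: of_bool_def)
  ultimately show ?thesis
    using assms parity_act_transvection_indicator[of "{..<n}" n Y "basis_vec a"]
    by (intro bexI[of _ "transvection n (basis_vec a) ?w"]) auto
qed

text \<open>Otherwise the inverse of \<open>A\<close> would carry the zero vector back to all-ones,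
  which is nonzero because n > 0.\<close>

lemma parity_act_full_nonempty:
  assumes "A \<in> carrier (GL_int n)" "n > 0"
  shows "parity_act n {..<n} A \<noteq> {}"
proof
  assume "parity_act n {..<n} A = {}"
  moreover obtain B where "B \<in> carrier_mat n n" "A * B = 1\<^sub>m n"
    using assms by (auto simp: carrier_GL_int)
  ultimately have "parity_act n {} B = {..<n}"
    using assms by (metis GL_int_carrier_mat parity_act_mult parity_act_one subset_refl)
  then show False
    using assms by (auto simp: parity_act_def)
qed

text \<open>Properness provides points inside and outside each set. A permutation first turns
  \<open>X\<close> into a set \<open>Z\<close> that agrees with \<open>Y\<close> at two points:
  \<open>a\<close> lies in both and \<open>b\<close> in neither. A transvection with u = e_a - e_b
  then moves \<open>Z\<close> to \<open>Y\<close>.\<close>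

lemma GL_int_odd_transitive:
  assumes X: "X \<subset> {..<n}" "X \<noteq> {}" and Y: "Y \<subset> {..<n}" "Y \<noteq> {}"
  shows "\<exists>A\<in>GL_int_odd n. parity_act n X A = Y"
proof -
  obtain i a where ia: "i \<in> X" "a \<in> Y"
    using X Y by blast
  obtain j b where jb: "j \<in> {..<n} - X" "b \<in> {..<n} - Y"
    using X(1) Y(1) by (meson psubset_imp_ex_mem)
  have ij: "i \<in> X" "j \<notin> X" "a \<in> Y" "b \<notin> Y" and lt: "i < n" "j < n" "a < n" "b < n"
    using ia jb X(1) Y(1) by auto
  then have ne: "i \<noteq> j" "a \<noteq> b"
    by auto
  obtain p0 where p0: "p0 permutes {..<n}" "p0 a = i"
    using permutes_redirect[OF permutes_id, of a "{..<n}" i] lt by auto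
  \<comment> \<open>The second redirection keeps the value at \<open>a\<close>, because
    \<open>a\<close> differs from \<open>b\<close> and \<open>p0 a = i\<close> differs from
    \<open>j\<close>.\<close>
  obtain p where p: "p permutes {..<n}" "p b = j" "\<And>z. z \<noteq> b \<Longrightarrow> p0 z \<noteq> j \<Longrightarrow> p z = p0 z"
    using permutes_redirect[OF p0(1), of b j] lt by auto
  have pv: "p a = i" "p b = j"
    using p ne p0 by auto
  define Z where "Z = {k. k < n \<and> p k \<in> X}"
  have Z: "Z \<subseteq> {..<n}" "a \<in> Z" "b \<notin> Z" "parity_act n X (perm_matrix n p) = Z"
    using pv ij lt X p(1) by (auto simp: Z_def parity_act_perm_matrix)
  \<comment> \<open>The total sum 0 keeps the matrix in the stabiliser, while the sum over
    \<open>Z\<close> is 1, so that \<open>Z\<close> is moved. The vector \<open>w\<close> below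
    vanishes at \<open>a\<close> and \<open>b\<close>, hence w . u = 0.\<close>
  define u where "u = (\<lambda>k. basis_vec a k - basis_vec b k)"
  define w :: "nat \<Rightarrow> int" where "w = (\<lambda>k. of_bool (k \<in> Y) - of_bool (k \<in> Z))"
  have "(\<Sum>k<n. w k * u k) = w a - w b"
    using lt by (simp add: u_def right_diff_distrib sum_subtractf sum_basis_vec del: sum_of_bool_mult_eq sum_mult_of_bool_eq)
  then have "transvection n u w \<in> carrier (GL_int n)"
    using ij Z by (intro transvection_GL_int) (simp add: w_def)
  moreover have "(\<Sum>k<n. u k) = 0"
    using lt by (simp add: u_def sum_subtractf of_bool_def)
  ultimately have T: "transvection n u w \<in> GL_int_odd n"
    by (intro transvection_GL_int_odd) simp_all
  have "(\<Sum>k\<in>Z. u k) = 1"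
    using Z finite_subset[OF Z(1)] by (simp add: u_def sum_subtractf of_bool_def)
  then have "parity_act n Z (transvection n u w) = Y"
    unfolding w_def using Z Y by (intro parity_act_transvection_indicator) auto
  then have "parity_act n X (perm_matrix n p * transvection n u w) = Y"
    using X Z by (subst parity_act_mult) auto
  moreover have "perm_matrix n p * transvection n u w \<in> GL_int_odd n"
    using subgroup.m_closed[OF subgroup_GL_int_odd perm_matrix_GL_int_odd[OF p(1)] T] by simp
  ultimately show ?thesis
    by blast
qed

section \<open>Cosets, index and maximality\<close>

text \<open>Orbit-stabiliser: \<open>A\<close> and \<open>B\<close> send all-ones to the same vector
  exactly when \<open>B\<close> times the inverse of \<open>A\<close> fixes it.\<close>

lemma GL_int_odd_coset_eq:
  assumes A: "A \<in> carrier (GL_int n)"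
  shows "GL_int_odd n #>\<^bsub>GL_int n\<^esub> A =
    {B \<in> carrier (GL_int n). parity_act n {..<n} B = parity_act n {..<n} A}"
proof -
  interpret group "GL_int n" by (rule group_GL_int)
  have "B \<in> GL_int_odd n #>\<^bsub>GL_int n\<^esub> A"
    if B: "B \<in> carrier (GL_int n)" "parity_act n {..<n} B = parity_act n {..<n} A" for B
  proof -
    let ?C = "inv\<^bsub>GL_int n\<^esub> A"
    have C: "?C \<in> carrier (GL_int n)" "A * ?C = 1\<^sub>m n"
      using A r_inv[of A] by auto
    from A B C(1) have "parity_act n {..<n} (B * ?C) = parity_act n {..<n} (A * ?C)"
      by (simp add: parity_act_mult GL_int_carrier_mat)
    then have "B * ?C \<in> GL_int_odd n"
      using m_closed[OF B(1) C(1)] C by (simp add: mem_GL_int_odd parity_act_one)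
    moreover have "B = (B * ?C) * A"
      using A B inv_solve_right'[of B A] m_assoc[of B ?C A] l_inv[of A] r_one[of B] by simp
    ultimately show ?thesis
      unfolding r_coset_def by auto
  qed
  moreover have "B \<in> carrier (GL_int n) \<and> parity_act n {..<n} B = parity_act n {..<n} A"
    if B: "B \<in> GL_int_odd n #>\<^bsub>GL_int n\<^esub> A" for B
  proof -
    obtain H where "H \<in> GL_int_odd n" "B = H * A"
      using B by (auto simp: r_coset_def)
    then show ?thesis
      using A m_closed[of H A] by (auto simp: mem_GL_int_odd parity_act_mult GL_int_carrier_mat)
  qed
  ultimately show ?thesis
    by blast
qed

lemma card_rcosets_GL_int_odd:
  assumes "n > 0"
  shows "card (rcosets\<^bsub>GL_int n\<^esub> (GL_int_odd n)) = 2 ^ n - 1"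
proof -
  let ?F = "\<lambda>X. {B \<in> carrier (GL_int n). parity_act n {..<n} B = X}"
  have img: "(parity_act n {..<n}) ` carrier (GL_int n) = Pow {..<n} - {{}}"
  proof
    show "(parity_act n {..<n}) ` carrier (GL_int n) \<subseteq> Pow {..<n} - {{}}"
      using assms parity_act_full_nonempty by (simp add: image_subset_iff parity_act_subset)
    show "Pow {..<n} - {{}} \<subseteq> (parity_act n {..<n}) ` carrier (GL_int n)"
      using parity_act_full_surj by blast
  qed
  have "rcosets\<^bsub>GL_int n\<^esub> (GL_int_odd n) = ?F ` (parity_act n {..<n} ` carrier (GL_int n))"
    unfolding RCOSETS_def by (auto simp: GL_int_odd_coset_eq)
  \<comment> \<open>Each value in the image has a nonempty fibre, and any member of the fibre
    determines the value.\<close>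
  moreover have "inj_on ?F (parity_act n {..<n} ` carrier (GL_int n))"
    by (auto intro!: inj_onI)
  ultimately have "card (rcosets\<^bsub>GL_int n\<^esub> (GL_int_odd n)) =
      card (parity_act n {..<n} ` carrier (GL_int n))"
    by (simp only: card_image)
  then show ?thesis
    unfolding img by (simp add: card_Pow card_Diff_singleton)
qed

text \<open>A larger subgroup \<open>K\<close> contains some \<open>M\<close> that moves all-ones to
  a proper nonempty \<open>X\<close>, and the stabiliser carries \<open>X\<close> to every other
  such set. So \<open>K\<close> meets every coset of the stabiliser, and since it contains the
  stabiliser it is everything.\<close>

lemma maximal_subgroup_GL_int_odd:
  assumes "n \<ge> 2"
  shows "maximal_subgroup (GL_int_odd n) (GL_int n)"
proof -
  interpret group "GL_int n" by (rule group_GL_int)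
  \<comment> \<open>An element moving all-ones to a singleton shows that the subgroup is proper; the
    singleton is not the full set because n >= 2.\<close>
  obtain A where A: "A \<in> carrier (GL_int n)" "parity_act n {..<n} A = {0}"
    using parity_act_full_surj[of "{0}" n] assms by auto
  moreover have "1 \<in> {..<n} - {0}"
    using assms by simp
  then have "{0} \<noteq> {..<n}"
    by blast
  ultimately have "A \<notin> GL_int_odd n"
    by (simp add: mem_GL_int_odd)
  then have "GL_int_odd n \<noteq> carrier (GL_int n)"
    using A by blast
  moreover have "K = carrier (GL_int n)"
    if K: "subgroup K (GL_int n)" "GL_int_odd n \<subseteq> K" "K \<noteq> GL_int_odd n" for K
  proof -
    obtain M where M: "M \<in> K" "M \<notin> GL_int_odd n"
      using K by blast
    have KG: "K \<subseteq> carrier (GL_int n)"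
      using K(1) by (rule subgroup.subset)
    define X where "X = parity_act n {..<n} M"
    have X: "X \<subset> {..<n}" "X \<noteq> {}"
      using M KG assms parity_act_subset[of n "{..<n}" M] parity_act_full_nonempty[of M n]
      by (auto simp: X_def mem_GL_int_odd)
    have "B \<in> K" if B: "B \<in> carrier (GL_int n)" for B
    proof -
      define Y where "Y = parity_act n {..<n} B"
      have "\<exists>C\<in>K. parity_act n {..<n} C = Y"
      proof (cases "Y = {..<n}")
        case True
        then show ?thesis
          using subgroup.one_closed[OF K(1)] by (auto intro!: bexI[of _ "1\<^sub>m n"] simp: parity_act_one)
      next
        case False
        then have "Y \<subset> {..<n}" "Y \<noteq> {}"
          using B assms parity_act_subset[of n "{..<n}" B] parity_act_full_nonempty[of B n]
          by (auto simp: Y_def)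
        then obtain H where H: "H \<in> GL_int_odd n" "parity_act n X H = Y"
          using GL_int_odd_transitive[OF X] by meson
        then have "H \<in> K"
          using K(2) by blast
        then have "M * H \<in> K" "M \<in> carrier_mat n n" "H \<in> carrier_mat n n"
          using subgroup.m_closed[OF K(1), of M H] M(1) KG by (simp_all add: GL_int_carrier_mat subsetD)
        then show ?thesis
          using H by (intro bexI[of _ "M * H"]) (simp_all add: parity_act_mult X_def)
      qed
      then obtain C where C: "C \<in> K" "parity_act n {..<n} C = Y"
        by blast
      then have "B \<in> GL_int_odd n #>\<^bsub>GL_int n\<^esub> C"
        using B KG by (simp add: GL_int_odd_coset_eq subsetD Y_def)
      then obtain H where "H \<in> GL_int_odd n" "B = H \<otimes>\<^bsub>GL_int n\<^esub> C"
        by (auto simp: r_coset_def)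
      then show ?thesis
        using subgroup.m_closed[OF K(1)] C K(2) by blast
    qed
    then show ?thesis
      using KG by blast
  qed
  ultimately show ?thesis
    unfolding maximal_subgroup_def using subgroup_GL_int_odd by blast
qed


section \<open>The generators as 1 + u w^T, and matrices with finished columns\<close>

lemma transvection_cong:
  "(\<And>i. i < n \<Longrightarrow> u i = v i) \<Longrightarrow> transvection n u w = transvection n v w"
  by (rule eq_matI) (auto simp: transvection_def)

text \<open>A reflection rather than a transvection: here \<open>w \<bullet> u = - 2\<close> instead of \<open>0\<close>.\<close>
lemma M_theta_eq: "M_theta n = transvection n (\<lambda>i. - 2 * basis_vec 0 i) (basis_vec 0)"
  by (rule eq_matI) (auto simp: M_theta_def transvection_def unit_matrix_def)

lemma M_mu_eq: "M_mu n = transvection n (\<lambda>i. 2 * basis_vec 1 i) (basis_vec 0)"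
  by (rule eq_matI) (auto simp: M_mu_def transvection_def unit_matrix_def)

lemma M_nu_eq: "M_nu n = transvection n (\<lambda>i. basis_vec 1 i + basis_vec 2 i) (basis_vec 0)"
  by (rule eq_matI) (auto simp: M_nu_def transvection_def unit_matrix_def)

lemma permutation_matrices_eq:
  "permutation_matrices n = {perm_matrix n p | p. p permutes {..<n}}"
  by (simp add: permutation_matrices_def perm_matrix_def)

lemma odd_column_sum:
  assumes "A \<in> GL_int_odd n" "j < n"
  shows "odd (\<Sum>i<n. A $$ (i, j))"
proof -
  have "j \<in> parity_act n {..<n} A"
    using assms by (simp add: mem_GL_int_odd)
  then show ?thesis
    by (simp add: parity_act_def)
qed

text \<open>The two ends of the column induction are \<open>j = 0\<close>, which is no condition,
  and \<open>j = n\<close>, where an n by n matrix must be the identity.\<close>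

definition standard_columns :: "nat \<Rightarrow> nat \<Rightarrow> int mat \<Rightarrow> bool" where
  "standard_columns n j A \<longleftrightarrow> (\<forall>l<j. \<forall>i<n. A $$ (i, l) = of_bool (i = l))"

text \<open>Row \<open>k\<close> is zero in the finished columns since k >= j, so adding multiples
  of it to any row, finished ones included, leaves them unchanged.\<close>

lemma standard_columns_transvection_mult:
  assumes "A \<in> carrier_mat n n" "standard_columns n j A" "j \<le> k" "k < n"
  shows "standard_columns n j (transvection n u (basis_vec k) * A)"
  using assms by (auto simp: standard_columns_def transvection_basis_mult_index)

text \<open>Row \<open>j\<close> of the inverse supplies \<open>c\<close>. The first
  \<open>j\<close> columns of \<open>A\<close> are unit vectors, which forces the entries of that
  row before position \<open>j\<close> to vanish, so only the rows from \<open>j\<close> on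
  contribute.\<close>

lemma GL_int_unimodular_column:
  assumes A: "A \<in> carrier (GL_int n)" "standard_columns n j A" "j < n"
  shows "\<exists>c. (\<Sum>i\<in>{j..<n}. c i * A $$ (i, j)) = 1"
proof -
  obtain B where B: "B \<in> carrier_mat n n" "B * A = 1\<^sub>m n"
    using A by (auto simp: carrier_GL_int)
  have BA: "(\<Sum>k<n. B $$ (j, k) * A $$ (k, l)) = of_bool (j = l)" if "l < n" for l
  proof -
    have "(\<Sum>k<n. B $$ (j, k) * A $$ (k, l)) = (B * A) $$ (j, l)"
      using B(1) GL_int_carrier_mat[OF A(1)] A(3) that by (rule index_mult_mat_sum[symmetric])
    then show ?thesis
      unfolding B(2) using A(3) that by simp
  qed
  have "B $$ (j, l) = 0" if l: "l < j" for l
  proof -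
    have "(\<Sum>k<n. B $$ (j, k) * A $$ (k, l)) = (\<Sum>k<n. B $$ (j, k) * of_bool (k = l))"
      using A(2) l by (intro sum.cong) (auto simp: standard_columns_def)
    also have "\<dots> = B $$ (j, l)"
      using l A(3) by (intro sum_basis_vec) simp
    finally show ?thesis
      using BA[of l] l A(3) by simp
  qed
  then have "(\<Sum>k\<in>{j..<n}. B $$ (j, k) * A $$ (k, j)) = (\<Sum>k<n. B $$ (j, k) * A $$ (k, j))"
    by (intro sum.mono_neutral_left) auto
  then show ?thesis
    using BA[OF A(3)] by auto
qed

section \<open>Transvections in a subgroup containing the permutation matrices\<close>

context
  fixes n :: nat and S :: "int mat set"
  assumes S: "subgroup S (GL_int n)"
    and perm_S: "\<And>p. p permutes {..<n} \<Longrightarrow> perm_matrix n p \<in> S"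
begin

lemma S_mult: "A \<in> S \<Longrightarrow> B \<in> S \<Longrightarrow> A * B \<in> S"
  using subgroup.m_closed[OF S, of A B] by simp

text \<open>Turns row reduction into a membership proof: \<open>A\<close> may be replaced by
  \<open>M * A\<close> for any \<open>M\<close> in \<open>S\<close>.\<close>

lemma S_cancel_left:
  assumes "M \<in> S" "M * A \<in> S" "A \<in> carrier (GL_int n)"
  shows "A \<in> S"
proof -
  interpret group "GL_int n" by (rule group_GL_int)
  have M: "M \<in> carrier (GL_int n)"
    using subgroup.subset[OF S] assms(1) by blast
  have "inv\<^bsub>GL_int n\<^esub> M \<otimes>\<^bsub>GL_int n\<^esub> (M \<otimes>\<^bsub>GL_int n\<^esub> A) \<in> S"
    using subgroup.m_closed[OF S subgroup.m_inv_closed[OF S assms(1)], of "M * A"] assms(2) by simp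
  also have "inv\<^bsub>GL_int n\<^esub> M \<otimes>\<^bsub>GL_int n\<^esub> (M \<otimes>\<^bsub>GL_int n\<^esub> A) = A"
    using M assms(3) by (simp only: m_assoc[symmetric] inv_closed l_inv l_one)
  finally show ?thesis .
qed

lemma transvection_permute_S:
  assumes p: "p permutes {..<n}" and T: "transvection n (u \<circ> p) (w \<circ> p) \<in> S"
  shows "transvection n u w \<in> S"
proof -
  let ?q = "inv_into UNIV p"
  have q: "?q permutes {..<n}"
    using p by (rule permutes_inv)
  have "transvection n u w * perm_matrix n p * perm_matrix n ?q \<in> S"
    unfolding perm_matrix_transvection[OF p, symmetric] by (intro S_mult perm_S p q T)
  also have "transvection n u w * perm_matrix n p * perm_matrix n ?q =
      transvection n u w * (perm_matrix n p * perm_matrix n ?q)"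
    by (rule assoc_mult_mat[of _ n n _ n _ n]) simp_all
  also have "\<dots> = transvection n u w"
    using p q by (simp add: perm_matrix_mult permutes_inv_o perm_matrix_id right_mult_one_mat[of _ n n])
  finally show ?thesis .
qed

lemma transvection_add_S:
  assumes "transvection n u w \<in> S" "transvection n v w \<in> S" "(\<Sum>k<n. w k * v k) = 0"
  shows "transvection n (\<lambda>i. u i + v i) w \<in> S"
  using S_mult[OF assms(1,2)] assms(3) by (simp add: transvection_mult)

lemma transvection_uminus_S:
  assumes "transvection n u w \<in> S" "(\<Sum>k<n. w k * u k) = 0"
  shows "transvection n (\<lambda>i. - u i) w \<in> S"
proof (rule S_cancel_left[OF assms(1)])
  have w: "(\<Sum>k<n. w k * - u k) = 0"
    using assms(2) by (simp add: sum_negf)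
  then show "transvection n u w * transvection n (\<lambda>i. - u i) w \<in> S"
    using subgroup.one_closed[OF S] by (simp add: transvection_mult transvection_zero)
  show "transvection n (\<lambda>i. - u i) w \<in> carrier (GL_int n)"
    using w by (rule transvection_GL_int)
qed

lemma transvection_scale_S:
  assumes "transvection n u w \<in> S" "(\<Sum>k<n. w k * u k) = 0"
  shows "transvection n (\<lambda>i. c * u i) w \<in> S"
proof -
  have nat: "transvection n (\<lambda>i. int m * u i) w \<in> S" for m
  proof (induction m)
    case 0
    show ?case
      using subgroup.one_closed[OF S] by (simp add: transvection_zero)
  next
    case (Suc m)
    show ?case
      using transvection_add_S[OF Suc assms] by (simp add: algebra_simps)
  qed
  have *: "(\<Sum>k<n. w k * (int m * u k)) = 0" for m
    using assms(2) by (simp add: mult.left_commute[of _ "int m"] sum_distrib_left[symmetric])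
  show ?thesis
  proof (cases c)
    case (nonneg m)
    then show ?thesis
      using nat by simp
  next
    case (neg m)
    show ?thesis
      using transvection_uminus_S[OF nat *, of "Suc m"] unfolding neg minus_mult_left .
  qed
qed

text \<open>This and the next two lemmas conjugate the given matrices by permutations, so that the
  coordinates 0, 1, 2 become arbitrary distinct indices.\<close>

lemma reflection_S:
  assumes "M_theta n \<in> S" "k < n"
  shows "transvection n (\<lambda>i. - 2 * basis_vec k i) (basis_vec k) \<in> S"
proof -
  obtain p where p: "p permutes {..<n}" "p 0 = k"
    using permutes_redirect[OF permutes_id, of 0 "{..<n}" k] assms(2) by auto
  have "p i = k \<longleftrightarrow> i = 0" for i
    using permutes_inj[OF p(1)] p(2) by (auto dest: injD)
  then show ?thesis
    using assms(1) by - (rule transvection_permute_S[OF p(1)], simp add: comp_def M_theta_eq)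
qed

lemma double_transvection_S:
  assumes "M_mu n \<in> S" "n \<ge> 2" "k < n" "i < n" "i \<noteq> k"
  shows "transvection n (\<lambda>l. 2 * basis_vec i l) (basis_vec k) \<in> S"
proof -
  obtain p where p: "p permutes {..<n}" "p 0 = k"
    using permutes_redirect[OF permutes_id, of 0 "{..<n}" k] assms by auto
  obtain q where q: "q permutes {..<n}" "q 1 = i" "\<And>z. z \<noteq> 1 \<Longrightarrow> p z \<noteq> i \<Longrightarrow> q z = p z"
    using permutes_redirect[OF p(1), of 1 i] assms by auto
  have "q 0 = k"
    using p q(3) assms by auto
  then have "q l = k \<longleftrightarrow> l = 0" "q l = i \<longleftrightarrow> l = 1" for l
    using permutes_inj[OF q(1)] q(2) by (auto dest: injD)
  then show ?thesis
    using assms(1) by - (rule transvection_permute_S[OF q(1)], simp add: comp_def M_mu_eq)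
qed

lemma sum_transvection_S:
  assumes "M_nu n \<in> S" "n \<ge> 3" "k < n" "i < n" "j < n" "i \<noteq> k" "j \<noteq> k" "i \<noteq> j"
  shows "transvection n (\<lambda>l. basis_vec i l + basis_vec j l) (basis_vec k) \<in> S"
proof -
  obtain p where p: "p permutes {..<n}" "p 0 = k"
    using permutes_redirect[OF permutes_id, of 0 "{..<n}" k] assms by auto
  obtain q where q: "q permutes {..<n}" "q 1 = i" "\<And>z. z \<noteq> 1 \<Longrightarrow> p z \<noteq> i \<Longrightarrow> q z = p z"
    using permutes_redirect[OF p(1), of 1 i] assms by auto
  have q0: "q 0 = k"
    using p q(3) assms by auto
  obtain r where r: "r permutes {..<n}" "r 2 = j" "\<And>z. z \<noteq> 2 \<Longrightarrow> q z \<noteq> j \<Longrightarrow> r z = q z"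
    using permutes_redirect[OF q(1), of 2 j] assms by auto
  have "r 0 = k" "r 1 = i"
    using q0 q(2) r(3) assms by auto
  then have "r l = k \<longleftrightarrow> l = 0" "r l = i \<longleftrightarrow> l = 1" "r l = j \<longleftrightarrow> l = 2" for l
    using permutes_inj[OF r(1)] r(2) by (auto dest: injD)
  then show ?thesis
    using assms(1) by - (rule transvection_permute_S[OF r(1)], simp add: comp_def M_nu_eq)
qed

text \<open>For an auxiliary \<open>j\<close> other than \<open>k\<close>, \<open>u\<close> is the
  sum of all u_i (e_i - e_j) plus m times 2 e_j, where 2m is its coordinate sum. Here e_i - e_j is
  e_i + e_j minus 2 e_j, and all these vectors add up freely as they vanish at
  \<open>k\<close>.\<close>

lemma even_transvection_S:
  assumes mu: "M_mu n \<in> S" and nu: "M_nu n \<in> S" and n: "n \<ge> 3"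
    and k: "k < n" and u: "u k = 0" "even (\<Sum>i<n. u i)"
  shows "transvection n u (basis_vec k) \<in> S"
proof -
  obtain j where j: "j < n" "j \<noteq> k"
  proof
    show "(if k = 0 then 1 else 0) < n" "(if k = 0 then 1 else 0) \<noteq> k"
      using n by auto
  qed
  have orth: "(\<Sum>l<n. basis_vec k l * v l) = 0" if "v k = 0" for v
    using sum_basis_vec(1)[OF k, of v] that by simp
  note double = double_transvection_S[OF mu _ k]
  have diff: "transvection n (\<lambda>l. u i * (basis_vec i l - basis_vec j l)) (basis_vec k) \<in> S"
    if i: "i < n" for i
  proof (cases "i = k \<or> i = j")
    \<comment> \<open>The vector is zero: \<open>u k = 0\<close> in one case, and the difference
      vanishes in the other.\<close>
    case True
    then show ?thesis
      using u subgroup.one_closed[OF S] by (auto simp: transvection_zero)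
  next
    case False
    have "transvection n (\<lambda>l. (basis_vec i l + basis_vec j l) + (- 1) * (2 * basis_vec j l))
        (basis_vec k) \<in> S"
      using n j i k False
      by (intro transvection_add_S sum_transvection_S[OF nu] transvection_scale_S double orth) simp_all
    then have "transvection n (\<lambda>l. basis_vec i l - basis_vec j l) (basis_vec k) \<in> S"
      by (simp add: algebra_simps)
    then show ?thesis
      using False j by (intro transvection_scale_S orth) simp_all
  qed
  have sum: "transvection n (\<lambda>l. \<Sum>i\<in>F. u i * (basis_vec i l - basis_vec j l)) (basis_vec k) \<in> S"
    if "finite F" "F \<subseteq> {..<n}" for F
    using that
  proof (induction F rule: finite_induct)
    case empty
    show ?case
      using subgroup.one_closed[OF S] by (simp add: transvection_zero)
  next
    case (insert a F)
    have "(\<Sum>i\<in>F. u i * (basis_vec i k - basis_vec j k)) = 0"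
      using u j by (intro sum.neutral) auto
    then have "transvection n (\<lambda>l. u a * (basis_vec a l - basis_vec j l) +
        (\<Sum>i\<in>F. u i * (basis_vec i l - basis_vec j l))) (basis_vec k) \<in> S"
      using insert by (intro transvection_add_S diff insert.IH orth) simp_all
    then show ?case
      using insert by simp
  qed
  obtain m where m: "(\<Sum>i<n. u i) = 2 * m"
    using u(2) by (elim evenE)
  have "transvection n (\<lambda>l. (\<Sum>i<n. u i * (basis_vec i l - basis_vec j l)) + m * (2 * basis_vec j l))
      (basis_vec k) \<in> S"
    using n j k by (intro transvection_add_S sum transvection_scale_S double orth) simp_all
  also have "transvection n (\<lambda>l. (\<Sum>i<n. u i * (basis_vec i l - basis_vec j l)) + m * (2 * basis_vec j l))
      (basis_vec k) = transvection n u (basis_vec k)"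
  proof (rule transvection_cong)
    fix l assume l: "l < n"
    have "(\<Sum>i<n. u i * (basis_vec i l - basis_vec j l)) = (\<Sum>i<n. u i * of_bool (l = i)) - (\<Sum>i<n. u i) * basis_vec j l"
      by (simp add: right_diff_distrib sum_subtractf sum_distrib_right del: sum_of_bool_mult_eq sum_mult_of_bool_eq)
    also have "\<dots> = u l - 2 * m * basis_vec j l"
      unfolding sum_basis_vec(4)[OF l] m ..
    finally show "(\<Sum>i<n. u i * (basis_vec i l - basis_vec j l)) + m * (2 * basis_vec j l) = u l"
      by simp
  qed
  finally show ?thesis .
qed

section \<open>Column reduction by even transvections\<close>

context
  assumes S_odd: "S \<subseteq> GL_int_odd n"
    and theta_S: "M_theta n \<in> S"
    and even_S: "\<And>k u. k < n \<Longrightarrow> u k = 0 \<Longrightarrow> even (\<Sum>i<n. u i) \<Longrightarrow>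
      transvection n u (basis_vec k) \<in> S"
begin

lemma S_mult_odd: "M \<in> S \<Longrightarrow> A \<in> GL_int_odd n \<Longrightarrow> M * A \<in> GL_int_odd n"
  using subgroup.m_closed[OF subgroup_GL_int_odd, of M n A] S_odd by auto

lemma S_cancel_left_odd: "M \<in> S \<Longrightarrow> M * A \<in> S \<Longrightarrow> A \<in> GL_int_odd n \<Longrightarrow> A \<in> S"
  by (rule S_cancel_left) (simp_all add: mem_GL_int_odd)

text \<open>Off the pivot only the finished rows can be nonzero, and one transvection with
  \<open>u\<close> equal to e_j minus the column clears them all. Its coordinate sum is 1 minus the
  odd column sum, hence even.\<close>

lemma clear_column:
  assumes A: "A \<in> GL_int_odd n" "standard_columns n j A" "j < n"
    and col: "\<And>i. i \<in> {j..<n} \<Longrightarrow> A $$ (i, j) = of_bool (i = j)"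
    and IH: "\<And>B. B \<in> GL_int_odd n \<Longrightarrow> standard_columns n (Suc j) B \<Longrightarrow> B \<in> S"
  shows "A \<in> S"
proof -
  have cA: "A \<in> carrier_mat n n"
    using A by (simp add: mem_GL_int_odd GL_int_carrier_mat)
  define u where "u = (\<lambda>i. of_bool (i = j) * 1 - A $$ (i, j))"
  have ujj: "u j = 0"
    using col[of j] A(3) by (simp add: u_def)
  have "(\<Sum>i<n. u i) = 1 - (\<Sum>i<n. A $$ (i, j))"
    unfolding u_def sum_subtractf sum_basis_vec(1)[OF A(3)] ..
  then have T: "transvection n u (basis_vec j) \<in> S"
    using odd_column_sum[OF A(1,3)] ujj A(3) by (intro even_S) simp_all
  moreover have "standard_columns n (Suc j) (transvection n u (basis_vec j) * A)"
    using standard_columns_transvection_mult[OF cA A(2) _ A(3), of u] cA A(3) col[of j]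
    by (auto simp: standard_columns_def less_Suc_eq transvection_basis_mult_index u_def)
  then have "transvection n u (basis_vec j) * A \<in> S"
    by (intro IH S_mult_odd T A)
  ultimately show ?thesis
    using A(1) by (rule S_cancel_left_odd)
qed

text \<open>A transposition brings the pivot to row \<open>j\<close>; it fixes all indices below
  \<open>j\<close>, so the finished columns survive. A pivot -1 is corrected by the reflection in
  coordinate \<open>j\<close>.\<close>

lemma pivot_column:
  assumes A: "A \<in> GL_int_odd n" "standard_columns n j A" "j < n"
    and r: "r \<in> {j..<n}" "\<bar>A $$ (r, j)\<bar> = 1"
    and zero: "\<And>i. i \<in> {j..<n} \<Longrightarrow> i \<noteq> r \<Longrightarrow> A $$ (i, j) = 0"
    and IH: "\<And>B. B \<in> GL_int_odd n \<Longrightarrow> standard_columns n (Suc j) B \<Longrightarrow> B \<in> S"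
  shows "A \<in> S"
proof -
  let ?p = "transpose r j"
  have p: "?p permutes {..<n}"
    using r A(3) by (intro permutes_swap_id) auto
  have cA: "A \<in> carrier_mat n n"
    using A by (simp add: mem_GL_int_odd GL_int_carrier_mat)
  define B where "B = perm_matrix n ?p * A"
  have B: "B \<in> GL_int_odd n" "B \<in> carrier_mat n n"
    using S_mult_odd[OF perm_S[OF p] A(1)] mult_carrier_mat[OF perm_matrix_carrier cA] by (simp_all add: B_def)
  have entry: "B $$ (i, l) = A $$ (?p i, l)" if "i < n" "l < n" for i l
    using perm_matrix_mult_index[OF cA p, of "?p i" l] permutes_in_image[OF p, of i] that
    by (simp add: B_def)
  have stdB: "standard_columns n j B"
    using A(2,3) r entry by (auto simp: standard_columns_def transpose_def)
  have colB: "B $$ (i, j) = of_bool (i = j) * A $$ (r, j)" if "i \<in> {j..<n}" for i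
    using that r A(3) zero[of i] zero[of j] by (auto simp: entry transpose_def)
  have "B \<in> S"
  proof (cases "A $$ (r, j) = 1")
    case True
    then show ?thesis
      using colB by (intro clear_column[OF B(1) stdB A(3) _ IH]) simp_all
  next
    case False
    then have neg: "A $$ (r, j) = - 1"
      using r(2) by linarith
    let ?T = "transvection n (\<lambda>i. - 2 * basis_vec j i) (basis_vec j)"
    have T: "?T \<in> S"
      using theta_S A(3) by (rule reflection_S)
    have "?T * B \<in> S"
    proof (rule clear_column[OF S_mult_odd[OF T B(1)] standard_columns_transvection_mult A(3) _ IH])
      fix i assume "i \<in> {j..<n}"
      then show "(?T * B) $$ (i, j) = of_bool (i = j)"
        using A(3) B(2) by (simp add: transvection_basis_mult_index colB neg)
    qed (use B stdB A in simp_all)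
    then show ?thesis
      using B(1) by (rule S_cancel_left_odd[OF T])
  qed
  then show ?thesis
    unfolding B_def using A(1) by (rule S_cancel_left_odd[OF perm_S[OF p]])
qed

text \<open>Descent on the sum of absolute values in column \<open>j\<close> over the rows from
  \<open>j\<close> on. Every move needs a \<open>u\<close> with even sum, so an entry changed alone
  is changed by an even multiple of another one, and units are removed with a partner row.\<close>

lemma reduce_column:
  assumes A: "A \<in> GL_int_odd n" "standard_columns n j A" "j < n"
    and IH: "\<And>B. B \<in> GL_int_odd n \<Longrightarrow> standard_columns n (Suc j) B \<Longrightarrow> B \<in> S"
  shows "A \<in> S"
  using A(1,2)
proof (induction "nat (\<Sum>i\<in>{j..<n}. \<bar>A $$ (i, j)\<bar>)" arbitrary: A rule: less_induct)
  case less
  have cA: "A \<in> carrier_mat n n" "A \<in> carrier (GL_int n)"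
    using less.prems by (simp_all add: mem_GL_int_odd GL_int_carrier_mat)
  \<comment> \<open>The descent move. The values of \<open>u\<close> on finished rows are
    constrained only by parity, because the measure ignores those rows.\<close>
  have step: "A \<in> S"
    if k: "k \<in> {j..<n}" and u: "u k = 0" "even (\<Sum>i<n. u i)"
      and le: "\<And>i. i \<in> {j..<n} \<Longrightarrow> \<bar>A $$ (i, j) + u i * A $$ (k, j)\<bar> \<le> \<bar>A $$ (i, j)\<bar>"
      and s: "s \<in> {j..<n}" "\<bar>A $$ (s, j) + u s * A $$ (k, j)\<bar> < \<bar>A $$ (s, j)\<bar>" for k u s
  proof -
    let ?T = "transvection n u (basis_vec k)"
    have T: "?T \<in> S"
      using k u by (intro even_S) simp_all
    have "(\<Sum>i\<in>{j..<n}. \<bar>(?T * A) $$ (i, j)\<bar>) = (\<Sum>i\<in>{j..<n}. \<bar>A $$ (i, j) + u i * A $$ (k, j)\<bar>)"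
      using k A(3) cA by (intro sum.cong) (simp_all add: transvection_basis_mult_index)
    also have "\<dots> < (\<Sum>i\<in>{j..<n}. \<bar>A $$ (i, j)\<bar>)"
      using le s by (intro sum_strict_mono_ex1) auto
    finally have "nat (\<Sum>i\<in>{j..<n}. \<bar>(?T * A) $$ (i, j)\<bar>) < nat (\<Sum>i\<in>{j..<n}. \<bar>A $$ (i, j)\<bar>)"
      by (subst nat_mono_iff) (auto intro: le_less_trans[rotated] sum_nonneg)
    then have "?T * A \<in> S"
      using k cA less.prems
      by (intro less.hyps S_mult_odd T standard_columns_transvection_mult) simp_all
    then show ?thesis
      using less.prems(1) by (rule S_cancel_left_odd[OF T])
  qed
  obtain c where c: "(\<Sum>i\<in>{j..<n}. c i * A $$ (i, j)) = 1"
    using GL_int_unimodular_column[OF cA(2) less.prems(2) A(3)] by blast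
  then obtain r where r: "r \<in> {j..<n}" "A $$ (r, j) \<noteq> 0"
    by (metis (no_types, lifting) mult_zero_right sum.neutral zero_neq_one)
  show ?case
  proof (cases "\<exists>k\<in>{j..<n}. \<exists>s\<in>{j..<n}. A $$ (k, j) \<noteq> 0 \<and> \<bar>A $$ (k, j)\<bar> < \<bar>A $$ (s, j)\<bar>")
    case True
    then obtain k s where ks: "k \<in> {j..<n}" "s \<in> {j..<n}" "A $$ (k, j) \<noteq> 0"
        "\<bar>A $$ (k, j)\<bar> < \<bar>A $$ (s, j)\<bar>"
      by blast
    \<comment> \<open>This is 2 or -2, with the sign that makes the new absolute value | |a_s| - 2
      |a_k| |; it is below |a_s| because 0 < |a_k| < |a_s|.\<close>
    define d where "d = - 2 * (sgn (A $$ (s, j)) * sgn (A $$ (k, j)))"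
    have dec: "\<bar>A $$ (s, j) + d * A $$ (k, j)\<bar> < \<bar>A $$ (s, j)\<bar>"
      using ks(3,4) unfolding d_def by (auto simp: sgn_if abs_if split: if_splits)
    have "(\<Sum>i<n. basis_vec s i * d) = d"
      using ks by (intro sum_basis_vec) simp
    then show ?thesis
      using ks dec by (intro step[of k "\<lambda>i. basis_vec s i * d" s]) (auto simp: d_def)
  next
    case False
    \<comment> \<open>All nonzero entries now have one common absolute value. It divides the
      combination equal to 1, so they are all units.\<close>
    have eq: "\<bar>A $$ (i, j)\<bar> = \<bar>A $$ (r, j)\<bar>" if "i \<in> {j..<n}" "A $$ (i, j) \<noteq> 0" for i
      using False that r by (meson linorder_neqE)
    then have "A $$ (r, j) dvd A $$ (i, j)" if "i \<in> {j..<n}" for i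
      using that by (cases "A $$ (i, j) = 0") (simp_all, metis abs_dvd_iff dvd_abs_iff dvd_refl)
    then have "A $$ (r, j) dvd (\<Sum>i\<in>{j..<n}. c i * A $$ (i, j))"
      by (intro dvd_sum dvd_mult) simp
    then have r1: "\<bar>A $$ (r, j)\<bar> = 1"
      using c by simp
    show ?thesis
    proof (cases "\<exists>s\<in>{j..<n}. s \<noteq> r \<and> A $$ (s, j) \<noteq> 0")
      case False
      then show ?thesis
        using r(1) r1 less.prems A(3) by (intro pivot_column[of A j r] IH) auto
    next
      case True
      then obtain s where s: "s \<in> {j..<n}" "s \<noteq> r" "A $$ (s, j) \<noteq> 0"
        by blast
      \<comment> \<open>Clearing row \<open>s\<close> alone is an odd move, so a row
        \<open>t\<close> must absorb the parity. Without one there would be no finished row, so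
        \<open>j = 0\<close>, and the column would consist of two units and zeros, with an even
        sum.\<close>
      have "\<exists>t<n. t \<noteq> r \<and> t \<noteq> s \<and> (t < j \<or> A $$ (t, j) \<noteq> 0)"
      proof (rule ccontr)
        assume no: "\<not> ?thesis"
        have "j = 0"
          using no[simplified, rule_format, of 0] s r A(3) by auto
        then have "(\<Sum>i<n. A $$ (i, j)) = (\<Sum>i\<in>{r, s}. A $$ (i, j))"
          using no r s by (intro sum.mono_neutral_right) auto
        also have "\<dots> = A $$ (r, j) + A $$ (s, j)"
          using s by simp
        finally show False
          using odd_column_sum[OF less.prems(1) A(3)] r1 eq[OF s(1,3)] by (auto simp: abs_if split: if_splits)
      qed
      then obtain t where t: "t < n" "t \<noteq> r" "t \<noteq> s" "t < j \<or> A $$ (t, j) \<noteq> 0"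
        by blast
      \<comment> \<open>The entry in row \<open>r\<close> is its own inverse, so these multiples of
        it cancel the entries in rows \<open>s\<close> and \<open>t\<close>. If \<open>t\<close> is
        a finished row, any odd value would serve for \<open>y\<close>.\<close>
      define x where "x = - (A $$ (s, j) * A $$ (r, j))"
      define y where "y = (if t < j then 1 else - (A $$ (t, j) * A $$ (r, j)))"
      have rr: "A $$ (r, j) * A $$ (r, j) = 1"
        using r1 by (auto simp: abs_if split: if_splits)
      have "odd x"
        using r1 eq[OF s(1,3)] by (auto simp: x_def abs_if split: if_splits)
      moreover have "odd y"
        using r1 eq[of t] t by (auto simp: y_def abs_if split: if_splits)
      moreover have "(\<Sum>i<n. basis_vec s i * x + basis_vec t i * y) = x + y"
        using s t by (simp add: sum.distrib sum_basis_vec del: sum_of_bool_mult_eq sum_mult_of_bool_eq)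
      ultimately have even: "even (\<Sum>i<n. basis_vec s i * x + basis_vec t i * y)"
        by simp
      have xs: "A $$ (s, j) + x * A $$ (r, j) = 0"
        using rr by (simp add: x_def mult.assoc)
      have yt: "A $$ (t, j) + y * A $$ (r, j) = 0" if "t \<ge> j"
        using rr that by (simp add: y_def mult.assoc)
      show ?thesis
      proof (rule step[OF r(1) _ even _ s(1)])
        show "\<bar>A $$ (i, j) + (basis_vec s i * x + basis_vec t i * y) * A $$ (r, j)\<bar> \<le> \<bar>A $$ (i, j)\<bar>"
          if "i \<in> {j..<n}" for i
          using that xs yt t by (cases "i = s"; cases "i = t") simp_all
        show "\<bar>A $$ (s, j) + (basis_vec s s * x + basis_vec t s * y) * A $$ (r, j)\<bar> < \<bar>A $$ (s, j)\<bar>"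
          using xs s t by simp
      qed (use s t in simp)
    qed
  qed
qed

text \<open>The induction runs downwards from \<open>j = n\<close>: \<open>reduce_column\<close>
  passes from \<open>Suc j\<close> finished columns to \<open>j\<close>.\<close>

lemma GL_int_odd_subset_S: "GL_int_odd n \<subseteq> S"
proof
  fix A assume A: "A \<in> GL_int_odd n"
  have "B \<in> S" if "j \<le> n" "B \<in> GL_int_odd n" "standard_columns n j B" for j B
    using that
  proof (induction j arbitrary: B rule: inc_induct)
    case base
    then have "B = 1\<^sub>m n"
      by (intro eq_matI) (auto simp: standard_columns_def mem_GL_int_odd dest: GL_int_carrier_mat)
    then show ?case
      using subgroup.one_closed[OF S] by simp
  next
    case (step j)
    then show ?case
      using reduce_column[of B j] by blast
  qed
  then show "A \<in> S"
    using A by (force simp: standard_columns_def)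
qed

end

end

section \<open>The group generated by the given matrices\<close>

lemma generate_GL_int_odd:
  assumes n: "n \<ge> 3"
  shows "generate (GL_int n) (permutation_matrices n \<union> {M_theta n, M_mu n, M_nu n}) = GL_int_odd n"
proof
  interpret group "GL_int n" by (rule group_GL_int)
  let ?gens = "permutation_matrices n \<union> {M_theta n, M_mu n, M_nu n}"
  let ?S = "generate (GL_int n) ?gens"
  \<comment> \<open>With w . u = -2 the product formula gives u + u - 2 u = 0, so
    \<open>M_theta n\<close> is its own inverse. Its invertibility needs this separate argument
    because w . u is not 0.\<close>
  have "(\<Sum>k<n. basis_vec 0 k * (- 2 * basis_vec 0 k)) = - 2"
    using n by (subst sum_basis_vec(1)) simp_all
  then have "M_theta n * M_theta n = 1\<^sub>m n"
    unfolding M_theta_eq transvection_mult by (simp only:) (simp add: transvection_zero)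
  then have "M_theta n \<in> carrier (GL_int n)"
    unfolding carrier_GL_int by (auto simp: M_theta_eq)
  then have "M_theta n \<in> GL_int_odd n"
    unfolding M_theta_eq by (rule transvection_GL_int_odd) (simp add: sum_distrib_left[symmetric] sum_negf)
  moreover have "M_mu n \<in> GL_int_odd n"
    unfolding M_mu_eq by (intro transvection_GL_int_odd transvection_GL_int) (simp_all add: sum_distrib_left[symmetric])
  moreover have "M_nu n \<in> GL_int_odd n"
    unfolding M_nu_eq using n
    by (intro transvection_GL_int_odd transvection_GL_int) (simp_all add: sum.distrib)
  ultimately have gens: "?gens \<subseteq> GL_int_odd n"
    by (auto simp: permutation_matrices_eq perm_matrix_GL_int_odd)
  then show sub: "?S \<subseteq> GL_int_odd n"
    by (rule generate_subgroup_incl[OF _ subgroup_GL_int_odd])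
  have S: "subgroup ?S (GL_int n)"
    using gens by (intro generate_is_subgroup) (auto simp: mem_GL_int_odd)
  have perm: "perm_matrix n p \<in> ?S" if "p permutes {..<n}" for p
    using that by (intro generate.incl) (auto simp: permutation_matrices_eq)
  have M: "M_theta n \<in> ?S" "M_mu n \<in> ?S" "M_nu n \<in> ?S"
    by (auto intro: generate.incl)
  show "GL_int_odd n \<subseteq> ?S"
    by (rule GL_int_odd_subset_S[OF S perm sub M(1) even_transvection_S[OF S perm M(2,3) n]])
qed


theorem lemma4p9:
  fixes n :: nat
  assumes "n \<ge> 2"
  shows "maximal_subgroup (GL_int_odd n) (GL_int n) \<and>
         card (rcosets\<^bsub>GL_int n\<^esub> (GL_int_odd n)) = 2 ^ n - 1 \<and>
         (n \<ge> 3 \<longrightarrow>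
           generate (GL_int n) (permutation_matrices n \<union> {M_theta n, M_mu n, M_nu n})
             = GL_int_odd n)"
  using assms maximal_subgroup_GL_int_odd card_rcosets_GL_int_odd[of n] generate_GL_int_odd by simp

end
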